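(* The following statements are equivalent: (i) $A\cap\operatorname{dom} f=\emptyset$; (ii) $\overline{\operatorname{epi} f^{*}+K}=\overline{\big(\operatorname{dom} f^{*}+\operatorname{cone}\Omega+\operatorname{barr} C\big)}\times\mathbb{R}$.
   Context: $X$ is a real locally convex Hausdorff topological vector space with topological dual $X^{*}$. $X^{*}$ carries the weak$^{*}$ topology, $X^{*}\times\mathbb{R}$ the corresponding product topology, and $\overline{E}$ denotes closure of $E$ in these topologies. $\Gamma(X)$ is the set of proper (never $-\infty$, not identically $+\infty$) lower semicontinuous convex functions $X\to\mathbb{R}\cup\{+\infty\}$. Data: $I$ is an arbitrary (possibly infinite) index set, $C\subset X$ is a nonempty closed convex set, $f_i\in\Gamma(X)$ for each $i\in I$, and $f\in\Gamma(X)$. $A:=\{x\in C: f_i(x)\le 0\ \forall i\in I\}$ (possibly empty). Notation: $\operatorname{dom} h=\{h<+\infty\}$; $\operatorname{epi} h=\{(x,r): r\in\mathbb{R},\ h(x)\le r\}$; $h^{*}(x^{*})=\sup_{x\in X}(\langle x^{*},x\rangle-h(x))$; $\delta_D$ is the indicator of $D$ ($0$ on $D$, $+\infty$ elsewhere); $\operatorname{barr} C=\operatorname{dom}\delta_C^{*}$; $\operatorname{cone} D$ is the convex cone generated by $D\cup\{0\}$. Moreover $$K:=\operatorname{cone}\Big(\operatorname{epi}\delta_C^{*}\cup\bigcup_{i\in I}\operatorname{epi} f_i^{*}\Big)\subset X^{*}\times\mathbb{R},\qquad \Omega:=\bigcup_{i\in I}\operatorname{dom} f_i^{*}\subset X^{*}.$$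 *)

theory Defs
  imports "HOL-Analysis.Analysis"
begin

section \<open>Real locally convex Hausdorff spaces\<close>

text \<open>Scalar multiplication is jointly continuous, and the origin has a neighbourhood base of open
  convex sets (the third conjunct of the second axiom is \<open>convex V\<close> unfolded, since that constant
  cannot be used inside a class specification).\<close>

class locally_convex_t2_space = real_vector + topological_ab_group_add + t2_space +
  assumes tendsto_scaleR_Pair:
    "LIM p (nhds c \<times>\<^sub>F nhds x). fst p *\<^sub>R snd p :> nhds (c *\<^sub>R x)"
  assumes convex_nhds_base_unfolded:
    "open U \<Longrightarrow> 0 \<in> U \<Longrightarrow> \<exists>V. open V \<and> 0 \<in> V \<and>
       (\<forall>x\<in>V. \<forall>y\<in>V. \<forall>u\<ge>0. \<forall>v\<ge>0. u + v = 1 \<longrightarrow> u *\<^sub>R x + v *\<^sub>R y \<in> V) \<and> V \<subseteq> U"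

lemma convex_nhds_base:
  fixes U :: "'a::locally_convex_t2_space set"
  assumes "open U" "0 \<in> U"
  shows "\<exists>V. open V \<and> 0 \<in> V \<and> convex V \<and> V \<subseteq> U"
  using convex_nhds_base_unfolded[OF assms] unfolding convex_def .

instance real_normed_vector \<subseteq> locally_convex_t2_space
proof
  fix c :: real and x :: 'a
  show "LIM p (nhds c \<times>\<^sub>F nhds x). fst p *\<^sub>R snd p :> nhds (c *\<^sub>R x)"
    by (intro tendsto_scaleR filterlim_fst filterlim_snd)
next
  fix U :: "'a set"
  assume "open U" "0 \<in> U"
  then obtain e where "e > 0" "ball 0 e \<subseteq> U"
    by (rule openE)
  then show "\<exists>V. open V \<and> 0 \<in> V \<and>
       (\<forall>x\<in>V. \<forall>y\<in>V. \<forall>u\<ge>0. \<forall>v\<ge>0. u + v = 1 \<longrightarrow> u *\<^sub>R x + v *\<^sub>R y \<in> V) \<and> V \<subseteq> U"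
    unfolding convex_def[symmetric] by (intro exI[of _ "ball 0 e"]) auto
qed


section \<open>The topological dual with the weak* topology\<close>

typedef (overloaded) 'a topdual =
    "{\<phi> :: 'a::locally_convex_t2_space \<Rightarrow> real. linear \<phi> \<and> continuous_on UNIV \<phi>}"
  morphisms dual_apply Abs_topdual
  by (rule exI[of _ "\<lambda>_. 0"]) (auto simp: linear_iff)

setup_lifting type_definition_topdual

instantiation topdual :: (locally_convex_t2_space) real_vector
begin

lift_definition zero_topdual :: "'a topdual" is "\<lambda>_. 0"
  by (auto simp: linear_iff)

lift_definition plus_topdual :: "'a topdual \<Rightarrow> 'a topdual \<Rightarrow> 'a topdual"
  is "\<lambda>\<phi> \<psi> x. \<phi> x + \<psi> x"
  by (auto simp: linear_iff algebra_simps intro!: continuous_intros)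

lift_definition minus_topdual :: "'a topdual \<Rightarrow> 'a topdual \<Rightarrow> 'a topdual"
  is "\<lambda>\<phi> \<psi> x. \<phi> x - \<psi> x"
  by (auto simp: linear_iff algebra_simps intro!: continuous_intros)

lift_definition uminus_topdual :: "'a topdual \<Rightarrow> 'a topdual"
  is "\<lambda>\<phi> x. - \<phi> x"
  by (auto simp: linear_iff intro!: continuous_intros)

lift_definition scaleR_topdual :: "real \<Rightarrow> 'a topdual \<Rightarrow> 'a topdual"
  is "\<lambda>c \<phi> x. c * \<phi> x"
  by (auto simp: linear_iff algebra_simps intro!: continuous_intros)

instance
  by standard (transfer; simp add: fun_eq_iff algebra_simps)+

end

text \<open>The functions \<open>'a \<Rightarrow> real\<close> carry the product topology, i.e. the topology of pointwise
  convergence; the weak* topology is the one it induces on the dual.\<close>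

instantiation topdual :: (locally_convex_t2_space) topological_space
begin

definition open_topdual :: "'a topdual set \<Rightarrow> bool" where
  "open_topdual U \<longleftrightarrow> (\<exists>W. open W \<and> U = dual_apply -` W)"

instance
proof
  show "open (UNIV :: 'a topdual set)"
    unfolding open_topdual_def by (intro exI[of _ UNIV]) auto
next
  fix S T :: "'a topdual set"
  assume "open S" "open T"
  then obtain V W where "open V" "S = dual_apply -` V" "open W" "T = dual_apply -` W"
    unfolding open_topdual_def by blast
  then show "open (S \<inter> T)"
    unfolding open_topdual_def by (intro exI[of _ "V \<inter> W"]) auto
next
  fix K :: "'a topdual set set"
  assume "\<forall>S\<in>K. open S"
  then obtain W where "\<And>S. S \<in> K \<Longrightarrow> open (W S) \<and> S = dual_apply -` W S"
    unfolding open_topdual_def by metis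
  then show "open (\<Union>K)"
    unfolding open_topdual_def by (intro exI[of _ "\<Union>(W ` K)"]) blast
qed

end


section \<open>Convex analysis\<close>

definition eff_dom :: "('a \<Rightarrow> ereal) \<Rightarrow> 'a set" where
  "eff_dom h = {x. h x < \<infinity>}"

definition epi :: "('a \<Rightarrow> ereal) \<Rightarrow> ('a \<times> real) set" where
  "epi h = {(x, r). h x \<le> ereal r}"

definition proper :: "('a \<Rightarrow> ereal) \<Rightarrow> bool" where
  "proper h \<longleftrightarrow> (\<forall>x. h x \<noteq> -\<infinity>) \<and> (\<exists>x. h x \<noteq> \<infinity>)"

definition lower_semicontinuous :: "('a::topological_space \<Rightarrow> ereal) \<Rightarrow> bool" where
  "lower_semicontinuous h \<longleftrightarrow> (\<forall>x. \<forall>c < h x. \<forall>\<^sub>F y in nhds x. c < h y)"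

text \<open>Only used for functions that never take the value \<open>-\<infinity>\<close>, so the right-hand side never
  involves \<open>\<infinity> - \<infinity>\<close>.\<close>

definition convex_fun :: "('a::real_vector \<Rightarrow> ereal) \<Rightarrow> bool" where
  "convex_fun h \<longleftrightarrow> (\<forall>x y. \<forall>t::real. 0 < t \<and> t < 1 \<longrightarrow>
     h ((1 - t) *\<^sub>R x + t *\<^sub>R y) \<le> ereal (1 - t) * h x + ereal t * h y)"

text \<open>The set usually written \<open>\<Gamma>(X)\<close>.\<close>

definition proper_lsc_convex :: "('a::locally_convex_t2_space \<Rightarrow> ereal) set" where
  "proper_lsc_convex = {h. proper h \<and> lower_semicontinuous h \<and> convex_fun h}"

definition conjugate :: "('a::locally_convex_t2_space \<Rightarrow> ereal) \<Rightarrow> 'a topdual \<Rightarrow> ereal" where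
  "conjugate h \<phi> = (SUP x. ereal (dual_apply \<phi> x) - h x)"

definition delta :: "'a set \<Rightarrow> 'a \<Rightarrow> ereal" where
  "delta D x = (if x \<in> D then 0 else \<infinity>)"

definition barr :: "'a::locally_convex_t2_space set \<Rightarrow> 'a topdual set" where
  "barr D = eff_dom (conjugate (delta D))"

definition gen_cone :: "'a::real_vector set \<Rightarrow> 'a set" where
  "gen_cone D = convex_cone hull (insert 0 D)"

end

theory Submission
  imports Defs
begin

text \<open>Write \<open>E = epi f\<^sup>* + K\<close> and \<open>D = dom f\<^sup>* + cone \<Omega> + barr C\<close>. The projection of \<open>E\<close> to \<open>X\<^sup>*\<close> is
  exactly \<open>D\<close>, because a linear map commutes with forming convex cones; hence \<open>closure E\<close> always
  lies in \<open>closure D \<times> \<real>\<close>, and only the vertical extent of \<open>closure E\<close> is in question.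

  A point \<open>x\<close> of \<open>A \<inter> dom f\<close> bounds that extent from below: the Fenchel-Young inequalities for \<open>f\<close>,
  \<open>\<delta>\<^sub>C\<close> and the \<open>f\<^sub>i\<close> add up to \<open>\<langle>y, x\<rangle> - s \<le> f x\<close> on \<open>E\<close>, and this weak* closed condition
  survives on \<open>closure E\<close>, which therefore contains no vertical line,
  whereas \<open>D\<close> is nonempty.

  Conversely, suppose that some \<open>(y\<^sub>0, r\<^sub>0)\<close> with \<open>y\<^sub>0 \<in> D\<close> is missing from \<open>closure E\<close>. It is separated
  from \<open>E\<close> by a weak* continuous functional, that is, by a point of \<open>X \<times> \<real>\<close>
  (\<open>weak_star_separation\<close>). The functional is not vertical, since \<open>E\<close> has points above \<open>y\<^sub>0\<close>, so
  after normalisation it is \<open>(y, s) \<mapsto> \<langle>y, x\<rangle> - s\<close> for some \<open>x \<in> X\<close>, bounded above on \<open>E\<close>. Boundedness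
  on \<open>epi f\<^sup>*\<close> says that \<open>f\<^sup>*\<^sup>* x\<close> is finite, boundedness on the cone \<open>K\<close> forces the functional to be
  nonpositive there, that is, \<open>\<delta>\<^sub>C\<^sup>*\<^sup>* x \<le> 0\<close> and \<open>f\<^sub>i\<^sup>*\<^sup>* x \<le> 0\<close>. By the Fenchel-Moreau theorem
  (\<open>fenchel_moreau\<close>) each biconjugate may be replaced by the function itself, so \<open>x \<in> A \<inter> dom f\<close>.

  Both separations, in \<open>X \<times> \<real>\<close> and in \<open>X\<^sup>* \<times> \<real>\<close>, come from one algebraic Hahn-Banach theorem in
  the form of Mazur and Orlicz (\<open>mazur_orlicz\<close>). The topology only enters through the choice of the
  dominating sublinear functional on the non-scalar component: the gauge of a convex neighbourhood
  in the first case, a finite sum of absolute values of evaluations in the second.\<close>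

section \<open>Sublinear functionals and linear minorants\<close>

text \<open>Homogeneity is only demanded as an inequality for positive factors; applied to a factor and
  to its inverse, this already yields equality.\<close>

definition sublinear :: "('a::real_vector \<Rightarrow> real) \<Rightarrow> bool" where
  "sublinear p \<longleftrightarrow> (\<forall>x y. p (x + y) \<le> p x + p y) \<and> (\<forall>c>0. \<forall>x. p (c *\<^sub>R x) \<le> c * p x)"

lemma sublinear_add: "sublinear p \<Longrightarrow> p (x + y) \<le> p x + p y"
  by (simp add: sublinear_def)

lemma sublinear_scale_pos:
  assumes "sublinear p" "c > 0"
  shows "p (c *\<^sub>R x) = c * p x"
proof (rule antisym)
  show "p (c *\<^sub>R x) \<le> c * p x"
    using assms by (simp add: sublinear_def)
  have "p ((1 / c) *\<^sub>R (c *\<^sub>R x)) \<le> (1 / c) * p (c *\<^sub>R x)"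
    using assms unfolding sublinear_def by (meson zero_less_divide_1_iff)
  then show "c * p x \<le> p (c *\<^sub>R x)"
    using assms(2) by (simp add: field_simps)
qed

lemma sublinear_0:
  assumes "sublinear p"
  shows "p 0 = 0"
  using sublinear_scale_pos[OF assms, of 2 0] by simp

lemma sublinear_scale:
  assumes "sublinear p" "c \<ge> 0"
  shows "p (c *\<^sub>R x) = c * p x"
  using assms sublinear_scale_pos[OF assms(1), of c x] sublinear_0[OF assms(1)]
  by (cases "c = 0") auto

lemma sublinear_neg_le:
  assumes "sublinear p"
  shows "- p (- x) \<le> p x"
  using sublinear_add[OF assms, of x "- x"] sublinear_0[OF assms] by simp

text \<open>The functional \<open>q x = inf {p (x + t e) - t c | t \<ge> 0, e \<in> E}\<close> does it. The choice \<open>t = 0\<close> gives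
  \<open>q \<le> p\<close> and \<open>t = 1\<close> gives \<open>q (- e) \<le> - c\<close>; the infimum is finite because \<open>t c \<le> p (t e)\<close> bounds the
  values below by \<open>- p (- x)\<close>; convexity of \<open>E\<close> makes the set of all pairs \<open>(t e, t)\<close> closed under
  addition, whence subadditivity. The lemma serves twice: for the set \<open>E\<close> to be separated, and for
  singletons in order to see that minimal sublinear functionals are linear.\<close>

lemma mazur_orlicz_step:
  fixes p :: "'a::real_vector \<Rightarrow> real"
  assumes p: "sublinear p" and E: "convex E" "E \<noteq> {}" and c: "\<And>e. e \<in> E \<Longrightarrow> c \<le> p e"
  obtains q where "sublinear q" "\<And>x. q x \<le> p x" "\<And>e. e \<in> E \<Longrightarrow> q (- e) \<le> - c"
proof -
  define S where "S x = (\<lambda>(t, e). p (x + t *\<^sub>R e) - t * c) ` ({0..} \<times> E)" for x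
  define q where "q x = Inf (S x)" for x
  have SI: "p (x + t *\<^sub>R e) - t * c \<in> S x" if "t \<ge> 0" "e \<in> E" for x t e
    unfolding S_def using that by force
  have ne: "S x \<noteq> {}" for x
    using E(2) unfolding S_def by auto
  have low: "- p (- x) \<le> s" if s: "s \<in> S x" for s x
  proof -
    obtain t e where te: "t \<ge> 0" "e \<in> E" "s = p (x + t *\<^sub>R e) - t * c"
      using s unfolding S_def by auto
    have "t * c \<le> p (t *\<^sub>R e)"
      using c[OF te(2)] te(1) by (simp add: sublinear_scale[OF p] mult_left_mono)
    also have "\<dots> \<le> p (x + t *\<^sub>R e) + p (- x)"
      using sublinear_add[OF p, of "x + t *\<^sub>R e" "- x"] by simp
    finally show ?thesis using te(3) by simp
  qed
  have bdd: "bdd_below (S x)" for x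
    using low by (rule bdd_belowI)
  have qle: "q x \<le> s" if "s \<in> S x" for x s
    unfolding q_def by (rule cInf_lower[OF that bdd])
  have geq: "m \<le> q x" if "\<And>s. s \<in> S x \<Longrightarrow> m \<le> s" for m x
    unfolding q_def by (rule cInf_greatest[OF ne that])
  have add: "q (x + y) \<le> a + b" if ab: "a \<in> S x" "b \<in> S y" for x y a b
  proof -
    obtain t e where te: "t \<ge> 0" "e \<in> E" "a = p (x + t *\<^sub>R e) - t * c"
      using ab unfolding S_def by auto
    obtain s d where sd: "s \<ge> 0" "d \<in> E" "b = p (y + s *\<^sub>R d) - s * c"
      using ab unfolding S_def by auto
    obtain g where g: "g \<in> E" "(t + s) *\<^sub>R g = t *\<^sub>R e + s *\<^sub>R d"
    proof (cases "t + s = 0")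
      case True
      then show ?thesis using te sd that[of e] by (simp add: add_nonneg_eq_0_iff)
    next
      case False
      then have pos: "t + s > 0" using te sd by simp
      have "(t / (t + s)) *\<^sub>R e + (s / (t + s)) *\<^sub>R d \<in> E"
        using te sd pos
        by (intro convexD[OF E(1)]) (auto simp: add_divide_distrib[symmetric])
      moreover have "(t + s) *\<^sub>R ((t / (t + s)) *\<^sub>R e + (s / (t + s)) *\<^sub>R d) = t *\<^sub>R e + s *\<^sub>R d"
        using pos by (simp add: scaleR_add_right)
      ultimately show ?thesis using that by blast
    qed
    have "q (x + y) \<le> p (x + y + (t + s) *\<^sub>R g) - (t + s) * c"
      using te sd g by (intro qle SI) auto
    also have "x + y + (t + s) *\<^sub>R g = (x + t *\<^sub>R e) + (y + s *\<^sub>R d)"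
      using g by simp
    also have "p \<dots> - (t + s) * c \<le> a + b"
      using sublinear_add[OF p, of "x + t *\<^sub>R e" "y + s *\<^sub>R d"] te sd by (simp add: algebra_simps)
    finally show ?thesis by simp
  qed
  have "sublinear q"
    unfolding sublinear_def
  proof (intro conjI allI impI)
    fix x y
    have "q (x + y) - q y \<le> a" if a: "a \<in> S x" for a
    proof -
      have "q (x + y) - a \<le> q y"
        using add[OF a] by (intro geq) (simp add: diff_le_eq add.commute[of _ a])
      then show ?thesis by simp
    qed
    then have "q (x + y) - q y \<le> q x"
      by (rule geq)
    then show "q (x + y) \<le> q x + q y" by simp
  next
    fix k :: real and x
    assume k: "k > 0"
    have "q (k *\<^sub>R x) / k \<le> a" if a: "a \<in> S x" for a
    proof -
      obtain t e where te: "t \<ge> 0" "e \<in> E" "a = p (x + t *\<^sub>R e) - t * c"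
        using a unfolding S_def by auto
      have "q (k *\<^sub>R x) \<le> p (k *\<^sub>R x + (k * t) *\<^sub>R e) - (k * t) * c"
        using te k by (intro qle SI) auto
      also have "k *\<^sub>R x + (k * t) *\<^sub>R e = k *\<^sub>R (x + t *\<^sub>R e)"
        by (simp add: algebra_simps)
      also have "p \<dots> - (k * t) * c = k * a"
        by (simp add: sublinear_scale_pos[OF p k] te(3) right_diff_distrib)
      finally show ?thesis
        using k by (simp add: field_simps)
    qed
    then have "q (k *\<^sub>R x) / k \<le> q x"
      by (rule geq)
    then show "q (k *\<^sub>R x) \<le> k * q x" using k by (simp add: field_simps)
  qed
  moreover have "q x \<le> p x" for x
  proof -
    obtain e where "e \<in> E" using E(2) by blast
    then show ?thesis using qle[OF SI[of 0 e x]] by simp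
  qed
  moreover have "q (- e) \<le> - c" if "e \<in> E" for e
    using qle[OF SI[of 1 e "- e"]] that sublinear_0[OF p] by simp
  ultimately show ?thesis using that by blast
qed

text \<open>Sublinearity alone makes the infimum finite: every \<open>q \<le> p\<close> satisfies
  \<open>q x \<ge> - q (- x) \<ge> - p (- x)\<close>, a bound independent of \<open>q\<close>.\<close>

lemma sublinear_INF_chain:
  fixes Q :: "('a::real_vector \<Rightarrow> real) set"
  assumes Q: "Q \<noteq> {}" "\<And>q. q \<in> Q \<Longrightarrow> sublinear q" "\<And>q x. q \<in> Q \<Longrightarrow> q x \<le> p x"
    and chain: "\<And>q r. q \<in> Q \<Longrightarrow> r \<in> Q \<Longrightarrow> (\<forall>x. q x \<le> r x) \<or> (\<forall>x. r x \<le> q x)"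
  shows "sublinear (\<lambda>x. INF q\<in>Q. q x)" "q \<in> Q \<Longrightarrow> (INF q\<in>Q. q x) \<le> q x"
proof -
  have "- p (- x) \<le> q x" if "q \<in> Q" for q x
    using sublinear_neg_le[OF Q(2)[OF that], of x] Q(3)[OF that, of "- x"] by simp
  then have bdd: "bdd_below ((\<lambda>q. q x) ` Q)" for x
    by (intro bdd_belowI[of _ "- p (- x)"]) auto
  have le: "(INF q\<in>Q. q x) \<le> q x" if "q \<in> Q" for q x
    by (rule cINF_lower[OF bdd that])
  then show "q \<in> Q \<Longrightarrow> (INF q\<in>Q. q x) \<le> q x" .
  have ge: "m \<le> (INF q\<in>Q. q x)" if "\<And>q. q \<in> Q \<Longrightarrow> m \<le> q x" for m x
    using that by (rule cINF_greatest[OF Q(1)])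
  let ?i = "\<lambda>x. INF q\<in>Q. q x"
  show "sublinear ?i"
    unfolding sublinear_def
  proof (intro conjI allI impI)
    fix x y
    have *: "?i (x + y) \<le> q x + r y" if qr: "q \<in> Q" "r \<in> Q" for q r
    proof -
      obtain m where m: "m \<in> Q" "m x \<le> q x" "m y \<le> r y"
        using chain[OF qr] qr by blast
      show ?thesis
        using le[OF m(1), of "x + y"] sublinear_add[OF Q(2)[OF m(1)], of x y] m by simp
    qed
    have "?i (x + y) - ?i y \<le> q x" if q: "q \<in> Q" for q
    proof -
      have "?i (x + y) - q x \<le> ?i y"
        using *[OF q] by (intro ge) (simp add: diff_le_eq add.commute[of _ "q x"])
      then show ?thesis by simp
    qed
    then have "?i (x + y) - ?i y \<le> ?i x" by (rule ge)
    then show "?i (x + y) \<le> ?i x + ?i y" by simp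
  next
    fix k :: real and x
    assume k: "k > 0"
    have "?i (k *\<^sub>R x) / k \<le> q x" if q: "q \<in> Q" for q
      using le[OF q, of "k *\<^sub>R x"] sublinear_scale_pos[OF Q(2)[OF q] k, of x] k
      by (simp add: field_simps)
    then have "?i (k *\<^sub>R x) / k \<le> ?i x" by (rule ge)
    then show "?i (k *\<^sub>R x) \<le> k * ?i x" using k by (simp add: field_simps)
  qed
qed

lemma minimal_sublinear_exists:
  fixes p :: "'a::real_vector \<Rightarrow> real"
  assumes p: "sublinear p"
  obtains m where "sublinear m" "\<And>x. m x \<le> p x"
    "\<And>q. sublinear q \<Longrightarrow> (\<And>x. q x \<le> m x) \<Longrightarrow> q = m"
proof -
  let ?A = "{q. sublinear q \<and> (\<forall>x. q x \<le> p x)}"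
  let ?P = "\<lambda>q r :: 'a \<Rightarrow> real. \<forall>x. r x \<le> q x"
  have po: "partial_order_on ?A (relation_of ?P ?A)"
    unfolding partial_order_on_def preorder_on_def refl_on_def trans_def antisym_def relation_of_def
    by (auto simp: fun_eq_iff intro: order_trans antisym)
  have ch: "\<exists>u\<in>?A. \<forall>a\<in>Q. ?P a u" if Q: "Q \<in> Chains (relation_of ?P ?A)" for Q
  proof (cases "Q = {}")
    case True
    then show ?thesis using p by auto
  next
    case False
    have mem: "sublinear q" "q x \<le> p x" if "q \<in> Q" for q x
      using Q that unfolding Chains_def relation_of_def by auto
    have "(\<forall>x. q x \<le> r x) \<or> (\<forall>x. r x \<le> q x)" if "q \<in> Q" "r \<in> Q" for q r
      using Q that unfolding Chains_def relation_of_def by auto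
    with False mem have inf: "sublinear (\<lambda>x. INF q\<in>Q. q x)"
      "q \<in> Q \<Longrightarrow> (INF q\<in>Q. q x) \<le> q x" for q x
      using sublinear_INF_chain[of Q p] by blast+
    obtain q where q: "q \<in> Q" using False by blast
    have "(INF q\<in>Q. q x) \<le> p x" for x
      using inf(2)[OF q] mem(2)[OF q] by (rule order_trans)
    then show ?thesis
      using inf by (intro bexI[of _ "\<lambda>x. INF q\<in>Q. q x"]) auto
  qed
  from predicate_Zorn[OF po ch] obtain m where m: "m \<in> ?A" "\<forall>a\<in>?A. ?P m a \<longrightarrow> a = m"
    by blast
  show ?thesis
  proof (rule that)
    show "q = m" if "sublinear q" "\<And>x. q x \<le> m x" for q
      using m that by (fastforce intro: order_trans)
  qed (use m in auto)
qed

text \<open>Applied to \<open>E = {y}\<close> and \<open>c = m y\<close>, the preceding construction yields a sublinear functional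
  below \<open>m\<close> that is at most \<open>- m y\<close> at \<open>- y\<close>. By minimality it is \<open>m\<close> itself, so \<open>m\<close> is odd, and an
  odd sublinear functional is linear.\<close>

lemma minimal_sublinear_imp_linear:
  fixes m :: "'a::real_vector \<Rightarrow> real"
  assumes m: "sublinear m" and min: "\<And>q. sublinear q \<Longrightarrow> (\<And>x. q x \<le> m x) \<Longrightarrow> q = m"
  shows "linear m"
proof -
  have neg: "m (- y) = - m y" for y
  proof -
    obtain q where q: "sublinear q" "\<And>x. q x \<le> m x" "q (- y) \<le> - m y"
      using mazur_orlicz_step[OF m, of "{y}" "m y"] by auto
    then have "q = m" by (intro min) auto
    then show ?thesis using q(3) sublinear_neg_le[OF m, of y] by simp
  qed
  have "m (x + y) = m x + m y" for x y
    using sublinear_add[OF m, of x y] sublinear_add[OF m, of "- x" "- y"] neg[of "x + y"]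
      neg[of x] neg[of y] by simp
  moreover have "m (c *\<^sub>R x) = c *\<^sub>R m x" for c x
  proof (cases "c \<ge> 0")
    case True
    then show ?thesis by (simp add: sublinear_scale[OF m])
  next
    case False
    then show ?thesis
      using sublinear_scale[OF m, of "- c" x] neg[of "c *\<^sub>R x"] by simp
  qed
  ultimately show ?thesis by (rule linearI)
qed

text \<open>Instead of extending a functional from a subspace, one pushes \<open>p\<close> down: first below \<open>- c\<close> on
  \<open>- E\<close>, then to a minimal sublinear functional. Linearity turns the bound on \<open>- E\<close> into the
  bound on \<open>E\<close>.\<close>

theorem mazur_orlicz:
  fixes p :: "'a::real_vector \<Rightarrow> real"
  assumes "sublinear p" "convex E" "E \<noteq> {}" "\<And>e. e \<in> E \<Longrightarrow> c \<le> p e"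
  obtains \<phi> where "linear \<phi>" "\<And>x. \<phi> x \<le> p x" "\<And>e. e \<in> E \<Longrightarrow> c \<le> \<phi> e"
proof -
  obtain q where q: "sublinear q" "\<And>x. q x \<le> p x" "\<And>e. e \<in> E \<Longrightarrow> q (- e) \<le> - c"
    using mazur_orlicz_step[OF assms] by blast
  obtain m where m: "sublinear m" "\<And>x. m x \<le> q x"
    "\<And>r. sublinear r \<Longrightarrow> (\<And>x. r x \<le> m x) \<Longrightarrow> r = m"
    using minimal_sublinear_exists[OF q(1)] by blast
  have lin: "linear m"
    using m(1,3) by (rule minimal_sublinear_imp_linear)
  show ?thesis
  proof (rule that[OF lin])
    show "m x \<le> p x" for x
      using m(2) q(2) by (rule order_trans)
    show "c \<le> m e" if "e \<in> E" for e
      using m(2)[of "- e"] q(3)[OF that] linear_neg[OF lin, of e] by simp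
  qed
qed

corollary separate_point_convex_sublinear:
  fixes p :: "'a::real_vector \<Rightarrow> real"
  assumes p: "sublinear p" and E: "convex E" "E \<noteq> {}" and gap: "\<And>e. e \<in> E \<Longrightarrow> 1 \<le> p (e - a)"
  obtains \<phi> where "linear \<phi>" "\<And>x. \<phi> x \<le> p x" "\<And>e. e \<in> E \<Longrightarrow> \<phi> a + 1 \<le> \<phi> e"
proof -
  have "convex ((\<lambda>e. e - a) ` E)"
    using E(1) by (rule convex_translation_subtract)
  then obtain \<phi> where \<phi>: "linear \<phi>" "\<And>x. \<phi> x \<le> p x" "\<And>e. e \<in> (\<lambda>e. e - a) ` E \<Longrightarrow> 1 \<le> \<phi> e"
    using mazur_orlicz[OF p, of "(\<lambda>e. e - a) ` E" 1] E(2) gap by auto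
  show ?thesis
  proof (rule that[OF \<phi>(1,2)])
    show "\<phi> a + 1 \<le> \<phi> e" if "e \<in> E" for e
      using \<phi>(3)[of "e - a"] that linear_diff[OF \<phi>(1), of e a] by simp
  qed
qed


section \<open>Gauges of convex neighbourhoods\<close>

lemma tendsto_scaleR_lc:
  fixes g :: "'b \<Rightarrow> 'a::locally_convex_t2_space"
  assumes "(f \<longlongrightarrow> c) F" "(g \<longlongrightarrow> x) F"
  shows "((\<lambda>y. f y *\<^sub>R g y) \<longlongrightarrow> c *\<^sub>R x) F"
  using filterlim_compose[OF tendsto_scaleR_Pair filterlim_Pair[OF assms]] by simp

text \<open>The Minkowski functional of \<open>V\<close>.\<close>

definition gauge_of :: "'a::real_vector set \<Rightarrow> 'a \<Rightarrow> real" where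
  "gauge_of V x = Inf {r. 0 < r \<and> (1 / r) *\<^sub>R x \<in> V}"

context
  fixes V :: "'a::locally_convex_t2_space set"
  assumes V: "open V" "0 \<in> V" "convex V"
begin

lemma absorbing: "\<exists>r>0. (1 / r) *\<^sub>R x \<in> V"
proof -
  have "((\<lambda>c. c *\<^sub>R x) \<longlongrightarrow> 0 *\<^sub>R x) (at_right 0)"
    by (intro tendsto_scaleR_lc tendsto_ident_at tendsto_const)
  then have "eventually (\<lambda>c. c *\<^sub>R x \<in> V) (at_right (0::real))"
    using V by (auto elim: topological_tendstoD)
  then obtain b where b: "b > (0::real)" "\<And>c. 0 < c \<Longrightarrow> c < b \<Longrightarrow> c *\<^sub>R x \<in> V"
    unfolding eventually_at_right_field by auto
  then show ?thesis
    by (intro exI[of _ "2 / b"]) simp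
qed

lemma gauge_of_le:
  assumes "0 < r" "(1 / r) *\<^sub>R x \<in> V"
  shows "gauge_of V x \<le> r"
  unfolding gauge_of_def using assms by (intro cInf_lower) (auto intro!: bdd_belowI[of _ 0])

lemma gauge_of_ge:
  assumes "\<And>r. 0 < r \<Longrightarrow> (1 / r) *\<^sub>R x \<in> V \<Longrightarrow> m \<le> r"
  shows "m \<le> gauge_of V x"
  unfolding gauge_of_def using assms absorbing[of x] by (intro cInf_greatest) auto

lemma gauge_of_nonneg: "0 \<le> gauge_of V x"
  by (rule gauge_of_ge) simp

lemma sublinear_gauge_of: "sublinear (gauge_of V)"
  unfolding sublinear_def
proof (intro conjI allI impI)
  fix x y
  have *: "gauge_of V (x + y) \<le> r + s"
    if "0 < r" "(1 / r) *\<^sub>R x \<in> V" "0 < s" "(1 / s) *\<^sub>R y \<in> V" for r s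
  proof (rule gauge_of_le)
    have "(r / (r + s)) *\<^sub>R ((1 / r) *\<^sub>R x) + (s / (r + s)) *\<^sub>R ((1 / s) *\<^sub>R y) \<in> V"
      using that by (intro convexD[OF V(3)]) (auto simp: add_divide_distrib[symmetric])
    then show "(1 / (r + s)) *\<^sub>R (x + y) \<in> V"
      using that by (simp add: scaleR_add_right)
  qed (use that in simp)
  have "gauge_of V (x + y) - gauge_of V y \<le> gauge_of V x"
  proof (rule gauge_of_ge)
    fix r :: real assume r: "0 < r" "(1 / r) *\<^sub>R x \<in> V"
    have "gauge_of V (x + y) - r \<le> gauge_of V y"
      using *[OF r] by (intro gauge_of_ge) (simp add: diff_le_eq add.commute[of _ r])
    then show "gauge_of V (x + y) - gauge_of V y \<le> r" by simp
  qed
  then show "gauge_of V (x + y) \<le> gauge_of V x + gauge_of V y" by simp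
next
  fix k :: real and x
  assume k: "k > 0"
  have "gauge_of V (k *\<^sub>R x) / k \<le> gauge_of V x"
  proof (rule gauge_of_ge)
    fix r :: real assume r: "0 < r" "(1 / r) *\<^sub>R x \<in> V"
    have "gauge_of V (k *\<^sub>R x) \<le> k * r"
      using r k by (intro gauge_of_le) auto
    then show "gauge_of V (k *\<^sub>R x) / k \<le> r"
      using k by (simp add: field_simps)
  qed
  then show "gauge_of V (k *\<^sub>R x) \<le> k * gauge_of V x"
    using k by (simp add: field_simps)
qed

lemma gauge_of_less_1_imp_mem:
  assumes "gauge_of V x < 1"
  shows "x \<in> V"
proof -
  obtain r where r: "0 < r" "(1 / r) *\<^sub>R x \<in> V" "r < 1"
    using gauge_of_ge[of x 1] assms by force
  have "r *\<^sub>R ((1 / r) *\<^sub>R x) + (1 - r) *\<^sub>R 0 \<in> V"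
    using r V(2) by (intro convexD[OF V(3)]) auto
  then show ?thesis using r by simp
qed

text \<open>Domination by the gauge means \<open>\<psi> \<le> 1\<close> on \<open>V\<close>, so \<open>\<bar>\<psi>\<bar>\<close> is small on small multiples of
  \<open>V \<inter> - V\<close>.\<close>

lemma linear_le_gauge_of_imp_continuous:
  assumes \<psi>: "linear \<psi>" "\<And>x. \<psi> x \<le> gauge_of V x"
  shows "continuous_on UNIV \<psi>"
  unfolding continuous_on_def
proof (intro ballI tendstoI)
  fix x :: 'a and e :: real
  assume e: "e > 0"
  have le1: "\<psi> y \<le> 1" if "y \<in> V" for y
    using \<psi>(2)[of y] gauge_of_le[of 1 y] that by simp
  have "((\<lambda>y. y - x) \<longlongrightarrow> x - x) (at x within UNIV)"
    by (intro tendsto_intros)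
  from tendsto_scaleR_lc[OF tendsto_const this]
  have "((\<lambda>y. k *\<^sub>R (y - x)) \<longlongrightarrow> k *\<^sub>R (x - x)) (at x within UNIV)" for k :: real .
  then have ev: "eventually (\<lambda>y. k *\<^sub>R (y - x) \<in> V) (at x within UNIV)" for k :: real
    using V by (intro topological_tendstoD) auto
  show "eventually (\<lambda>y. dist (\<psi> y) (\<psi> x) < e) (at x within UNIV)"
    using ev[of "2 / e"] ev[of "- (2 / e)"]
  proof eventually_elim
    case (elim y)
    have "(2 / e) * (\<psi> y - \<psi> x) \<le> 1" "- (2 / e) * (\<psi> y - \<psi> x) \<le> 1"
      using le1[OF elim(1)] le1[OF elim(2)]
      unfolding linear_cmul[OF \<psi>(1)] linear_diff[OF \<psi>(1)] by simp_all
    then show ?case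
      using e by (simp add: dist_real_def field_simps abs_less_iff)
  qed
qed

end


section \<open>Conjugates of proper lower semicontinuous convex functions\<close>

lemma dual_apply_linear: "linear (dual_apply y)"
  and dual_apply_continuous: "continuous_on UNIV (dual_apply y)"
  using dual_apply[of y] by auto

lemmas dual_apply_simps [simp] =
  zero_topdual.rep_eq plus_topdual.rep_eq minus_topdual.rep_eq uminus_topdual.rep_eq
  scaleR_topdual.rep_eq

lemma mem_epi: "(x, r) \<in> epi h \<longleftrightarrow> h x \<le> ereal r"
  by (simp add: epi_def)

text \<open>The symmetric form of the Fenchel-Young inequality. It trades extended real arithmetic for
  real inequalities; the quantifier over \<open>r\<close> also accounts for the values \<open>\<plusminus>\<infinity>\<close> of \<open>h\<close>.\<close>

lemma mem_epi_conjugate: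
  "(y, s) \<in> epi (conjugate h) \<longleftrightarrow> (\<forall>x r. (x, r) \<in> epi h \<longrightarrow> dual_apply y x \<le> r + s)"
proof -
  have "(ereal a - v \<le> ereal s) \<longleftrightarrow> (\<forall>r. v \<le> ereal r \<longrightarrow> a \<le> r + s)" for a v
  proof (cases v)
    case (real b)
    then show ?thesis by (fastforce simp: algebra_simps)
  next
    case MInf
    then show ?thesis by (auto intro!: exI[of _ "a - s - 1"])
  qed auto
  then show ?thesis
    by (auto simp: mem_epi conjugate_def SUP_le_iff)
qed

lemma epi_conjugate_mono:
  "(y, s) \<in> epi (conjugate h) \<Longrightarrow> s \<le> s' \<Longrightarrow> (y, s') \<in> epi (conjugate h)"
  by (auto simp: mem_epi intro: order_trans)

lemma convex_epi_conjugate: "convex (epi (conjugate h))"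
proof (rule convexI, clarify)
  fix y s z t and u v :: real
  assume yz: "(y, s) \<in> epi (conjugate h)" "(z, t) \<in> epi (conjugate h)"
    and uv: "0 \<le> u" "0 \<le> v" "u + v = 1"
  have "u * dual_apply y x + v * dual_apply z x \<le> r + (u * s + v * t)" if "(x, r) \<in> epi h" for x r
  proof -
    have "u * dual_apply y x + v * dual_apply z x \<le> u * (r + s) + v * (r + t)"
      using yz that uv unfolding mem_epi_conjugate by (intro add_mono mult_left_mono) auto
    also have "\<dots> = (u + v) * r + (u * s + v * t)" by (simp add: algebra_simps)
    finally show ?thesis using uv(3) by simp
  qed
  then show "u *\<^sub>R (y, s) + v *\<^sub>R (z, t) \<in> epi (conjugate h)"
    by (simp add: mem_epi_conjugate)
qed

lemma ereal_less_PInf_iff_le_real: "a < \<infinity> \<longleftrightarrow> (\<exists>s. a \<le> ereal s)"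
  by (cases a) auto

lemma fst_epi: "fst ` epi h = eff_dom h"
proof -
  have "x \<in> fst ` epi h \<longleftrightarrow> (\<exists>r. h x \<le> ereal r)" for x
    by (force simp: epi_def)
  then show ?thesis
    unfolding eff_dom_def ereal_less_PInf_iff_le_real by blast
qed

lemma convex_epi:
  fixes h :: "'a::real_vector \<Rightarrow> ereal"
  assumes "convex_fun h"
  shows "convex (epi h)"
  unfolding convex_alt
proof (intro ballI allI impI, clarify)
  fix x r y s and u :: real
  assume xy: "(x, r) \<in> epi h" "(y, s) \<in> epi h" and u: "0 \<le> u" "u \<le> 1"
  show "(1 - u) *\<^sub>R (x, r) + u *\<^sub>R (y, s) \<in> epi h"
  proof (cases "u = 0 \<or> u = 1")
    case True
    then show ?thesis using xy by auto
  next
    case False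
    then have "h ((1 - u) *\<^sub>R x + u *\<^sub>R y) \<le> ereal (1 - u) * h x + ereal u * h y"
      using assms u unfolding convex_fun_def by auto
    also have "\<dots> \<le> ereal (1 - u) * ereal r + ereal u * ereal s"
      using xy u by (intro add_mono ereal_mult_left_mono) (auto simp: mem_epi)
    finally show ?thesis by (simp add: mem_epi)
  qed
qed

text \<open>Lower semicontinuity keeps \<open>epi h\<close> away from a neighbourhood of \<open>(x\<^sub>0, r\<^sub>0)\<close>: over \<open>x\<^sub>0 + V\<close> it
  lies above a level \<open>c > r\<^sub>0\<close>. So \<open>p (x, r) = gauge_of V x + \<bar>r\<bar> / (c - r\<^sub>0)\<close> is at least \<open>1\<close> on
  \<open>epi h - (x\<^sub>0, r\<^sub>0)\<close>, and a linear functional below \<open>p\<close> is automatically continuous in \<open>x\<close>. Its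
  vertical component \<open>b\<close> is nonnegative because \<open>epi h\<close> is unbounded upwards; \<open>b = 0\<close> remains
  possible when \<open>x\<^sub>0\<close> lies outside the domain of \<open>h\<close>.\<close>

lemma separate_below_epi:
  fixes h :: "'a::locally_convex_t2_space \<Rightarrow> ereal"
  assumes h: "h \<in> proper_lsc_convex" and r0: "ereal r0 < h x0"
  obtains y b where "b \<ge> 0" "\<And>x r. (x, r) \<in> epi h \<Longrightarrow> dual_apply y x0 + b * r0 + 1 \<le> dual_apply y x + b * r"
proof -
  have h': "proper h" "lower_semicontinuous h" "convex_fun h"
    using h by (auto simp: proper_lsc_convex_def)
  obtain c where c: "ereal r0 < ereal c" "ereal c < h x0"
    using ereal_dense2[OF r0] by blast
  then have "eventually (\<lambda>x. ereal c < h x) (nhds x0)"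
    using h'(2) unfolding lower_semicontinuous_def by blast
  then obtain W where W: "open W" "x0 \<in> W" "\<And>x. x \<in> W \<Longrightarrow> ereal c < h x"
    unfolding eventually_nhds by blast
  have "open ((\<lambda>z. x0 + z) -` W)"
    by (intro open_vimage W(1) continuous_intros)
  then obtain V where V: "open V" "0 \<in> V" "convex V" "V \<subseteq> (\<lambda>z. x0 + z) -` W"
    using convex_nhds_base[of "(\<lambda>z. x0 + z) -` W"] W(2) by auto
  define d where "d = c - r0"
  have d: "d > 0" using c(1) by (simp add: d_def)
  define p :: "'a \<times> real \<Rightarrow> real" where "p z = gauge_of V (fst z) + \<bar>snd z\<bar> / d" for z
  have p: "sublinear p"
    unfolding sublinear_def
  proof (intro conjI allI impI)
    fix z w :: "'a \<times> real"
    have "\<bar>snd z + snd w\<bar> / d \<le> (\<bar>snd z\<bar> + \<bar>snd w\<bar>) / d"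
      using d by (intro divide_right_mono) auto
    then show "p (z + w) \<le> p z + p w"
      using sublinear_add[OF sublinear_gauge_of[OF V(1-3)], of "fst z" "fst w"]
      by (simp add: p_def add_divide_distrib)
  next
    fix k :: real and z :: "'a \<times> real"
    assume "k > 0"
    then show "p (k *\<^sub>R z) \<le> k * p z"
      by (simp add: p_def sublinear_scale_pos[OF sublinear_gauge_of[OF V(1-3)]] abs_mult algebra_simps)
  qed
  have gap: "1 \<le> p (e - (x0, r0))" if e: "e \<in> epi h" for e
  proof -
    obtain x r where xr: "e = (x, r)" "h x \<le> ereal r" using e by (cases e) (auto simp: mem_epi)
    show ?thesis
    proof (cases "x - x0 \<in> V")
      case True
      then have "ereal c < h x" using V(4) W(3)[of x] by auto
      then have "ereal c < ereal r" using xr(2) by (rule less_le_trans)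
      then have "1 \<le> \<bar>r - r0\<bar> / d" using d by (simp add: d_def field_simps)
      then show ?thesis
        using gauge_of_nonneg[OF V(1-3), of "x - x0"] by (simp add: p_def xr(1))
    next
      case False
      then have "1 \<le> gauge_of V (x - x0)"
        using gauge_of_less_1_imp_mem[OF V(1-3)] by force
      moreover have "0 \<le> \<bar>r - r0\<bar> / d" using d by simp
      ultimately show ?thesis by (simp add: p_def xr(1))
    qed
  qed
  obtain x1 where "h x1 \<noteq> \<infinity>" using h'(1) by (auto simp: proper_def)
  then have "h x1 < \<infinity>" by simp
  then obtain s1 where s1: "(x1, s1) \<in> epi h"
    unfolding ereal_less_PInf_iff_le_real mem_epi by blast
  then have "epi h \<noteq> {}" by blast
  from separate_point_convex_sublinear[OF p convex_epi[OF h'(3)] this gap]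
  obtain \<phi> where \<phi>: "linear \<phi>" "\<And>z. \<phi> z \<le> p z" "\<And>e. e \<in> epi h \<Longrightarrow> \<phi> (x0, r0) + 1 \<le> \<phi> e"
    by auto
  define \<psi> where "\<psi> x = \<phi> (x, 0)" for x
  define b where "b = \<phi> (0, 1)"
  have split: "\<phi> (x, r) = \<psi> x + b * r" for x r
  proof -
    have "\<phi> (x, r) = \<phi> ((x, 0) + r *\<^sub>R (0, 1))" by simp
    also have "\<dots> = \<psi> x + b * r"
      unfolding linear_add[OF \<phi>(1)] linear_cmul[OF \<phi>(1)] \<psi>_def b_def by simp
    finally show ?thesis .
  qed
  have lin: "linear \<psi>"
  proof (rule linearI)
    show "\<psi> (x + y) = \<psi> x + \<psi> y" for x y
      using linear_add[OF \<phi>(1), of "(x, 0)" "(y, 0)"] by (simp add: \<psi>_def)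
    show "\<psi> (k *\<^sub>R x) = k *\<^sub>R \<psi> x" for k x
      using linear_cmul[OF \<phi>(1), of k "(x, 0)"] by (simp add: \<psi>_def)
  qed
  have "\<psi> x \<le> gauge_of V x" for x
    using \<phi>(2)[of "(x, 0)"] by (simp add: \<psi>_def p_def)
  then have "continuous_on UNIV \<psi>"
    using lin by (intro linear_le_gauge_of_imp_continuous[OF V(1-3)])
  then have Abs: "dual_apply (Abs_topdual \<psi>) = \<psi>"
    using lin by (intro Abs_topdual_inverse) simp
  have key: "\<psi> x0 + b * r0 + 1 \<le> \<psi> x + b * r" if "(x, r) \<in> epi h" for x r
    using \<phi>(3)[OF that] by (simp add: split)
  have "b \<ge> 0"
  proof (rule ccontr)
    assume "\<not> b \<ge> 0"
    then have b: "b < 0" by simp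
    \<comment> \<open>High enough above \<open>x1\<close>, the term \<open>b * t\<close> violates the separation inequality.\<close>
    define t where "t = max s1 ((\<psi> x0 + b * r0 - \<psi> x1) / b)"
    have "(x1, t) \<in> epi h"
      using s1 by (auto simp: mem_epi t_def intro: order_trans)
    from key[OF this] have "\<psi> x0 + b * r0 + 1 \<le> \<psi> x1 + b * t" .
    moreover have "b * t \<le> \<psi> x0 + b * r0 - \<psi> x1"
    proof -
      have "(\<psi> x0 + b * r0 - \<psi> x1) / b \<le> t" by (simp add: t_def)
      then show ?thesis using b by (simp add: field_simps)
    qed
    ultimately show False by simp
  qed
  then show ?thesis
    using that[of b "Abs_topdual \<psi>"] key by (simp add: Abs)
qed

text \<open>A nonvertical separating hyperplane is the graph of an affine function below \<open>h\<close>; dividing by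
  \<open>b\<close> gives its slope \<open>- y / b\<close>.\<close>

lemma affine_minorant_of_nonvertical:
  assumes b: "b > 0"
    and sep: "\<And>x r. (x, r) \<in> epi h \<Longrightarrow> dual_apply y x0 + b * r0 + 1 \<le> dual_apply y x + b * r"
  obtains y' s where "(y', s) \<in> epi (conjugate h)" "r0 \<le> dual_apply y' x0 - s"
proof -
  define y' where "y' = (- (1 / b)) *\<^sub>R y"
  have "(y', dual_apply y' x0 - r0) \<in> epi (conjugate h)"
    unfolding mem_epi_conjugate
  proof (intro allI impI)
    fix x r assume "(x, r) \<in> epi h"
    from sep[OF this] have "b * (r0 - r) \<le> dual_apply y x - dual_apply y x0"
      by (simp add: right_diff_distrib)
    then have "r0 - r \<le> (dual_apply y x - dual_apply y x0) / b"
      using b by (simp add: pos_le_divide_eq mult.commute)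
    then show "dual_apply y' x \<le> r + (dual_apply y' x0 - r0)"
      by (simp add: y'_def diff_divide_distrib)
  qed
  then show ?thesis by (intro that[of y' "dual_apply y' x0 - r0"]) auto
qed

text \<open>At a point \<open>x\<^sub>0\<close> where \<open>h\<close> is finite, a hyperplane separating \<open>epi h\<close> from a point below
  \<open>(x\<^sub>0, h x\<^sub>0)\<close> cannot be vertical.\<close>

lemma epi_conjugate_nonempty:
  assumes h: "h \<in> proper_lsc_convex"
  shows "epi (conjugate h) \<noteq> {}"
proof -
  obtain x0 where x0: "h x0 \<noteq> \<infinity>" "h x0 \<noteq> - \<infinity>"
    using h by (auto simp: proper_lsc_convex_def proper_def)
  then obtain v where v: "h x0 = ereal v" by (cases "h x0") auto
  then have "ereal (v - 1) < h x0" by simp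
  then obtain y b where yb: "b \<ge> 0"
    "\<And>x r. (x, r) \<in> epi h \<Longrightarrow> dual_apply y x0 + b * (v - 1) + 1 \<le> dual_apply y x + b * r"
    by (rule separate_below_epi[OF h]) (rule that)
  have "b \<noteq> 0"
    using yb(2)[of x0 v] v by (auto simp: mem_epi)
  then have "b > 0" using yb(1) by simp
  then obtain y' s where "(y', s) \<in> epi (conjugate h)"
    by (rule affine_minorant_of_nonvertical[OF _ yb(2)])
  then show ?thesis by blast
qed

text \<open>This is \<open>h \<le> h\<^sup>*\<^sup>*\<close>, the nontrivial half of the Fenchel-Moreau theorem. If the separating
  hyperplane is vertical, its functional \<open>y\<close> is at least \<open>\<langle>y, x\<^sub>0\<rangle> + 1\<close> on \<open>dom h\<close>; tilting any affine
  minorant with slope \<open>z\<close> to slope \<open>z - t y\<close> then raises its admissible value at \<open>x\<^sub>0\<close> by \<open>t\<close>, which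
  for large \<open>t\<close> reaches \<open>r\<^sub>0\<close>.\<close>

theorem fenchel_moreau:
  assumes h: "h \<in> proper_lsc_convex" and r0: "ereal r0 < h x0"
  obtains y s where "(y, s) \<in> epi (conjugate h)" "r0 \<le> dual_apply y x0 - s"
proof -
  obtain y b where yb: "b \<ge> 0"
    "\<And>x r. (x, r) \<in> epi h \<Longrightarrow> dual_apply y x0 + b * r0 + 1 \<le> dual_apply y x + b * r"
    by (rule separate_below_epi[OF h r0]) (rule that)
  show ?thesis
  proof (cases "b = 0")
    case False
    then have "b > 0" using yb(1) by simp
    then show ?thesis
      by (rule affine_minorant_of_nonvertical[where h = h, OF _ yb(2)]) (assumption, rule that)
  next
    case True
    obtain z s where z: "(z, s) \<in> epi (conjugate h)"
      using epi_conjugate_nonempty[OF h] by auto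
    define t where "t = max 0 (r0 - dual_apply z x0 + s)"
    have "(z - t *\<^sub>R y, s - t * (dual_apply y x0 + 1)) \<in> epi (conjugate h)"
      unfolding mem_epi_conjugate
    proof (intro allI impI)
      fix x r assume xr: "(x, r) \<in> epi h"
      have "t * (dual_apply y x0 + 1) \<le> t * dual_apply y x"
        using yb(2)[OF xr] True by (intro mult_left_mono) (auto simp: t_def)
      moreover have "dual_apply z x \<le> r + s"
        using z xr by (simp add: mem_epi_conjugate)
      ultimately show "dual_apply (z - t *\<^sub>R y) x \<le> r + (s - t * (dual_apply y x0 + 1))"
        by simp
    qed
    moreover have "r0 - dual_apply z x0 + s \<le> t"
      by (simp add: t_def)
    then have "r0 \<le> dual_apply (z - t *\<^sub>R y) x0 - (s - t * (dual_apply y x0 + 1))"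
      by (simp add: distrib_left)
    ultimately show ?thesis
      by (rule that)
  qed
qed

corollary le_of_epi_conjugate_bound:
  assumes h: "h \<in> proper_lsc_convex"
    and bound: "\<And>y s. (y, s) \<in> epi (conjugate h) \<Longrightarrow> dual_apply y x - s \<le> c"
  shows "h x \<le> ereal c"
proof (rule ccontr)
  assume "\<not> h x \<le> ereal c"
  then have "ereal c < h x" by simp
  then obtain r where r: "ereal c < ereal r" "ereal r < h x"
    using ereal_dense2 by blast
  then obtain y s where "(y, s) \<in> epi (conjugate h)" "r \<le> dual_apply y x - s"
    using fenchel_moreau[OF h] by blast
  then show False using bound[of y s] r(1) by simp
qed

lemma delta_proper_lsc_convex:
  assumes "closed D" "convex D" "D \<noteq> {}"
  shows "delta D \<in> proper_lsc_convex"
proof -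
  have "eventually (\<lambda>y. c < delta D y) (nhds x)" if "c < delta D x" for c x
  proof (cases "x \<in> D")
    case True
    then have "c < 0" using that by (simp add: delta_def)
    then have "c < delta D y" for y by (cases c) (auto simp: delta_def)
    then show ?thesis by simp
  next
    case False
    then have "eventually (\<lambda>y. y \<in> - D) (nhds x)"
      using assms(1) by (intro eventually_nhds_in_open) auto
    moreover have "c < \<infinity>" using that False by (simp add: delta_def)
    ultimately show ?thesis
      by (elim eventually_mono) (auto simp: delta_def)
  qed
  moreover have "convex_fun (delta D)"
    using assms(2) unfolding convex_fun_def convex_alt by (auto simp: delta_def)
  ultimately show ?thesis
    using assms(3) by (auto simp: proper_lsc_convex_def proper_def lower_semicontinuous_def delta_def)
qed

lemma mem_epi_conjugate_delta:
  "(y, s) \<in> epi (conjugate (delta D)) \<longleftrightarrow> (\<forall>x\<in>D. dual_apply y x \<le> s)"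
proof -
  have "(x, r) \<in> epi (delta D) \<longleftrightarrow> x \<in> D \<and> 0 \<le> r" for x r
    by (simp add: mem_epi delta_def)
  then show ?thesis
    unfolding mem_epi_conjugate by force
qed

text \<open>The epigraph of the support function is cut out by homogeneous linear inequalities, hence a
  convex cone, and the barrier cone is its projection.\<close>

lemma convex_cone_barr: "convex_cone (barr D)"
proof -
  have "convex_cone (epi (conjugate (delta D)))"
    unfolding convex_cone_iff
    by (auto simp: zero_prod_def mem_epi_conjugate_delta intro!: add_mono mult_left_mono)
  then have "convex_cone (fst ` epi (conjugate (delta D)))"
    using convex_cone_linear_image linear_fst by blast
  then show ?thesis
    by (simp add: fst_epi barr_def)
qed


section \<open>Separation in the weak* topology\<close>

text \<open>A functional that vanishes on the common kernel of finitely many functionals is a linear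
  combination of them; evaluations at points of \<open>X\<close> combine to an evaluation at a single point. In
  the induction step, a dual vector \<open>v\<close> that kills \<open>F\<close> but not \<open>a\<close> determines the coefficient of the
  evaluation at \<open>a\<close>; if there is no such \<open>v\<close>, the constraint at \<open>a\<close> is redundant.\<close>

lemma linear_combination_of_evaluations:
  fixes \<Phi> :: "'a::locally_convex_t2_space topdual \<Rightarrow> real"
  assumes "finite F" "linear \<Phi>" "\<And>y. (\<forall>x\<in>F. dual_apply y x = 0) \<Longrightarrow> \<Phi> y = 0"
  obtains z where "\<And>y. \<Phi> y = dual_apply y z"
proof -
  have "\<exists>z. \<forall>y. \<Phi> y = dual_apply y z"
    using assms
  proof (induction F arbitrary: \<Phi> rule: finite_induct)
    case empty
    then show ?case
      by (auto intro!: exI[of _ 0] simp: linear_0[OF dual_apply_linear])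
  next
    case (insert a F)
    show ?case
    proof (cases "\<exists>v. (\<forall>x\<in>F. dual_apply v x = 0) \<and> dual_apply v a \<noteq> 0")
      case False
      then show ?thesis using insert by (intro insert.IH) auto
    next
      case True
      then obtain v where v: "\<forall>x\<in>F. dual_apply v x = 0" "dual_apply v a \<noteq> 0" by blast
      define k where "k = \<Phi> v / dual_apply v a"
      have "\<exists>z. \<forall>y. \<Phi> y - k * dual_apply y a = dual_apply y z"
      proof (rule insert.IH)
        show "linear (\<lambda>y. \<Phi> y - k * dual_apply y a)"
          by (rule linearI)
            (simp_all add: linear_add[OF insert.prems(1)] linear_cmul[OF insert.prems(1)] algebra_simps)
        fix y :: "'a topdual"
        assume y: "\<forall>x\<in>F. dual_apply y x = 0"
        have "\<Phi> (y - (dual_apply y a / dual_apply v a) *\<^sub>R v) = 0"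
          using y v by (intro insert.prems(2)) auto
        then show "\<Phi> y - k * dual_apply y a = 0"
          by (simp add: linear_diff[OF insert.prems(1)] linear_cmul[OF insert.prems(1)] k_def)
      qed
      then obtain z where z: "\<And>y. \<Phi> y - k * dual_apply y a = dual_apply y z" by blast
      have "\<Phi> y = dual_apply y (z + k *\<^sub>R a)" for y
        using z[of y] by (simp add: linear_add[OF dual_apply_linear] linear_cmul[OF dual_apply_linear])
      then show ?thesis by blast
    qed
  qed
  then show ?thesis using that by blast
qed

lemma weak_star_basic_nhd:
  fixes y0 :: "'a::locally_convex_t2_space topdual"
  assumes "open U" "y0 \<in> U"
  obtains F e where "finite F" "e > 0"
    "\<And>y. (\<forall>x\<in>F. \<bar>dual_apply y x - dual_apply y0 x\<bar> < e) \<Longrightarrow> y \<in> U"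
proof -
  obtain W where W: "open W" "U = dual_apply -` W"
    using assms(1) unfolding open_topdual_def by blast
  have "openin (product_topology (\<lambda>_. euclidean) UNIV) W"
    using W(1) by (simp add: open_fun_def)
  then obtain X where X: "dual_apply y0 \<in> Pi\<^sub>E UNIV X" "\<And>i. open (X i)" "finite {i. X i \<noteq> UNIV}"
    "Pi\<^sub>E UNIV X \<subseteq> W"
    using product_topology_open_contains_basis[of "\<lambda>_. euclidean" UNIV W "dual_apply y0"] assms(2) W(2)
    by auto
  let ?F = "{i. X i \<noteq> UNIV}"
  have "\<exists>e>0. ball (dual_apply y0 i) e \<subseteq> X i" for i
    using X(1,2) open_contains_ball[of "X i"] by auto
  then obtain e where e: "\<And>i. e i > 0" "\<And>i. ball (dual_apply y0 i) (e i) \<subseteq> X i"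
    by metis
  define d where "d = Min (insert 1 (e ` ?F))"
  have d: "d > 0" "\<And>i. i \<in> ?F \<Longrightarrow> d \<le> e i"
    using X(3) e(1) by (auto simp: d_def)
  show ?thesis
  proof (rule that[OF X(3) d(1)])
    fix y
    assume y: "\<forall>x\<in>?F. \<bar>dual_apply y x - dual_apply y0 x\<bar> < d"
    have "dual_apply y i \<in> X i" for i
    proof (cases "i \<in> ?F")
      case True
      then have "dual_apply y i \<in> ball (dual_apply y0 i) (e i)"
        using y d(2)[OF True] by (force simp: dist_real_def abs_minus_commute)
      then show ?thesis using e(2) by blast
    qed auto
    then show "y \<in> U" using X(4) W(2) by auto
  qed
qed

text \<open>A weak* neighbourhood of \<open>(y\<^sub>0, r\<^sub>0)\<close> avoiding \<open>E\<close> is controlled by finitely many points \<open>F\<close>, so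
  \<open>p (y, r) = (\<Sum>x\<in>F. \<bar>\<langle>y, x\<rangle>\<bar>) / e + \<bar>r\<bar> / d\<close> is at least \<open>1\<close> on \<open>E - (y\<^sub>0, r\<^sub>0)\<close>. A linear functional
  below \<open>p\<close> vanishes on the common kernel of \<open>F\<close> in \<open>X\<^sup>* \<times> {0}\<close>, and is therefore given by a point
  \<open>(z, t)\<close> of \<open>X \<times> \<real>\<close>.\<close>

theorem weak_star_separation:
  fixes E :: "('a::locally_convex_t2_space topdual \<times> real) set"
  assumes E: "convex E" "E \<noteq> {}" and out: "(y0, r0) \<notin> closure E"
  obtains z t where "\<And>y r. (y, r) \<in> E \<Longrightarrow> dual_apply y0 z + t * r0 + 1 \<le> dual_apply y z + t * r"
proof -
  have "open (- closure E)" "(y0, r0) \<in> - closure E" using out by auto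
  then obtain U T where UT: "open U" "open T" "(y0, r0) \<in> U \<times> T" "U \<times> T \<subseteq> - closure E"
    by (rule open_prod_elim)
  obtain F e where F: "finite F" "e > 0"
    "\<And>y. (\<forall>x\<in>F. \<bar>dual_apply y x - dual_apply y0 x\<bar> < e) \<Longrightarrow> y \<in> U"
    using weak_star_basic_nhd[OF UT(1), of y0] UT(3) by auto
  obtain d where d: "d > 0" "\<And>r. \<bar>r - r0\<bar> < d \<Longrightarrow> r \<in> T"
    using UT(2,3) by (auto simp: open_real abs_minus_commute dist_real_def open_dist)
  define p :: "'a topdual \<times> real \<Rightarrow> real"
    where "p w = (\<Sum>x\<in>F. \<bar>dual_apply (fst w) x\<bar>) / e + \<bar>snd w\<bar> / d" for w
  have p: "sublinear p"
    unfolding sublinear_def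
  proof (intro conjI allI impI)
    fix w v :: "'a topdual \<times> real"
    have "(\<Sum>x\<in>F. \<bar>dual_apply (fst w) x + dual_apply (fst v) x\<bar>) / e
        \<le> ((\<Sum>x\<in>F. \<bar>dual_apply (fst w) x\<bar>) + (\<Sum>x\<in>F. \<bar>dual_apply (fst v) x\<bar>)) / e"
      using F(2) unfolding sum.distrib[symmetric] by (intro divide_right_mono sum_mono) auto
    moreover have "\<bar>snd w + snd v\<bar> / d \<le> (\<bar>snd w\<bar> + \<bar>snd v\<bar>) / d"
      using d(1) by (intro divide_right_mono) auto
    ultimately show "p (w + v) \<le> p w + p v"
      by (simp add: p_def add_divide_distrib)
  next
    fix k :: real and w :: "'a topdual \<times> real"
    assume "k > 0"
    then show "p (k *\<^sub>R w) \<le> k * p w"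
      by (simp add: p_def abs_mult sum_distrib_left[symmetric] algebra_simps)
  qed
  have gap: "1 \<le> p (w - (y0, r0))" if w: "w \<in> E" for w
  proof -
    obtain y r where yr: "w = (y, r)" by (cases w)
    have "y \<notin> U \<or> r \<notin> T"
      using UT(4) w closure_subset[of E] yr by blast
    then show ?thesis
    proof
      assume "y \<notin> U"
      then obtain x where x: "x \<in> F" "e \<le> \<bar>dual_apply y x - dual_apply y0 x\<bar>"
        using F(3)[of y] by force
      note x(2)
      also have "\<bar>dual_apply y x - dual_apply y0 x\<bar> \<le> (\<Sum>x\<in>F. \<bar>dual_apply y x - dual_apply y0 x\<bar>)"
        using F(1) x(1) by (intro member_le_sum) auto
      finally have "1 \<le> (\<Sum>x\<in>F. \<bar>dual_apply y x - dual_apply y0 x\<bar>) / e"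
        using F(2) by (simp add: field_simps)
      moreover have "0 \<le> \<bar>r - r0\<bar> / d" using d(1) by simp
      ultimately show ?thesis by (simp add: p_def yr)
    next
      assume "r \<notin> T"
      then have "1 \<le> \<bar>r - r0\<bar> / d" using d by (force simp: field_simps)
      moreover have "0 \<le> (\<Sum>x\<in>F. \<bar>dual_apply y x - dual_apply y0 x\<bar>) / e"
        using F(2) by (simp add: sum_nonneg)
      ultimately show ?thesis by (simp add: p_def yr)
    qed
  qed
  obtain \<phi> where \<phi>: "linear \<phi>" "\<And>w. \<phi> w \<le> p w" "\<And>w. w \<in> E \<Longrightarrow> \<phi> (y0, r0) + 1 \<le> \<phi> w"
    using separate_point_convex_sublinear[OF p E gap] by auto
  define \<Phi> where "\<Phi> y = \<phi> (y, 0)" for y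
  have lin: "linear \<Phi>"
  proof (rule linearI)
    show "\<Phi> (x + y) = \<Phi> x + \<Phi> y" for x y
      using linear_add[OF \<phi>(1), of "(x, 0)" "(y, 0)"] by (simp add: \<Phi>_def)
    show "\<Phi> (k *\<^sub>R x) = k *\<^sub>R \<Phi> x" for k x
      using linear_cmul[OF \<phi>(1), of k "(x, 0)"] by (simp add: \<Phi>_def)
  qed
  have "\<Phi> y = 0" if y: "\<forall>x\<in>F. dual_apply y x = 0" for y
    using \<phi>(2)[of "(y, 0)"] \<phi>(2)[of "(- y, 0)"] linear_neg[OF lin, of y] y
    by (simp add: \<Phi>_def p_def)
  then obtain z where z: "\<And>y. \<Phi> y = dual_apply y z"
    using linear_combination_of_evaluations[OF F(1) lin] by blast
  have split: "\<phi> (y, r) = dual_apply y z + \<phi> (0, 1) * r" for y r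
  proof -
    have "\<phi> (y, r) = \<phi> ((y, 0) + r *\<^sub>R (0, 1))" by simp
    also have "\<dots> = \<Phi> y + r * \<phi> (0, 1)"
      unfolding linear_add[OF \<phi>(1)] linear_cmul[OF \<phi>(1)] \<Phi>_def by simp
    finally show ?thesis by (simp add: z)
  qed
  show ?thesis
    by (rule that[of z "\<phi> (0, 1)"]) (use \<phi>(3) in \<open>simp add: split[symmetric]\<close>)
qed

lemma continuous_evaluation: "continuous_on UNIV (\<lambda>y. dual_apply y x)"
proof -
  have "continuous_on UNIV (dual_apply :: 'a topdual \<Rightarrow> 'a \<Rightarrow> real)"
    unfolding continuous_on_open_vimage[OF open_UNIV] by (auto simp: open_topdual_def)
  then show ?thesis
    by (rule continuous_on_product_then_coordinatewise)
qed


section \<open>Inconsistency as a closure identity\<close>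

lemma fst_set_plus: "fst ` (S + T) = fst ` S + fst ` T"
  by (force simp: set_plus_def)

lemma gen_cone_eq: "gen_cone S = convex_cone hull S"
  unfolding gen_cone_def
  by (rule hull_redundant) (rule convex_cone_hull_contains_0)

lemma gen_cone_superset: "S \<subseteq> gen_cone S"
  by (simp add: gen_cone_eq hull_subset)

theorem theorem4p3:
  fixes C :: "'a::locally_convex_t2_space set"
    and I :: "'i set"
    and f\<^sub>I :: "'i \<Rightarrow> 'a \<Rightarrow> ereal"
    and f :: "'a \<Rightarrow> ereal"
    and A :: "'a set"
    and K :: "('a topdual \<times> real) set"
    and \<Omega> :: "'a topdual set"
  assumes "C \<noteq> {}" and "closed C" and "convex C"
    and "\<And>i. i \<in> I \<Longrightarrow> f\<^sub>I i \<in> proper_lsc_convex"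
    and "f \<in> proper_lsc_convex"
  defines "A \<equiv> {x \<in> C. \<forall>i\<in>I. f\<^sub>I i x \<le> 0}"
    and "K \<equiv> gen_cone (epi (conjugate (delta C)) \<union> (\<Union>i\<in>I. epi (conjugate (f\<^sub>I i))))"
    and "\<Omega> \<equiv> \<Union>i\<in>I. eff_dom (conjugate (f\<^sub>I i))"
  shows "A \<inter> eff_dom f = {} \<longleftrightarrow>
    closure (epi (conjugate f) + K)
      = closure (eff_dom (conjugate f) + gen_cone \<Omega> + barr C) \<times> (UNIV :: real set)"
proof -
  let ?G = "epi (conjugate (delta C)) \<union> (\<Union>i\<in>I. epi (conjugate (f\<^sub>I i)))"
  let ?E = "epi (conjugate f) + K"
  let ?D = "eff_dom (conjugate f) + gen_cone \<Omega> + barr C"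
  have cone_K: "convex_cone K"
    by (simp add: K_def gen_cone_eq convex_cone_convex_cone_hull)
  have "fst ` K = convex_cone hull (fst ` ?G)"
    by (simp add: K_def gen_cone_eq convex_cone_hull_linear_image linear_fst)
  also have "fst ` ?G = \<Omega> \<union> barr C"
    by (auto simp: image_Un image_UN fst_epi barr_def \<Omega>_def)
  also have "convex_cone hull (\<Omega> \<union> barr C) = gen_cone \<Omega> + barr C"
    using hull_same[of convex_cone, OF convex_cone_barr[of C]]
    by (auto simp: convex_cone_hull_Un gen_cone_eq set_plus_def)
  finally have fst_E: "fst ` ?E = ?D"
    by (simp add: fst_set_plus fst_epi add.assoc)
  have convex_E: "convex ?E"
    using cone_K by (intro convex_set_plus convex_epi_conjugate) (simp add: convex_cone_def)
  obtain y1 s1 where y1: "(y1, s1) \<in> epi (conjugate f)"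
    using epi_conjugate_nonempty[OF assms(5)] by auto
  have epi_E: "w \<in> ?E" if "w \<in> epi (conjugate f)" for w
    using set_plus_intro[OF that convex_cone_contains_0[OF cone_K]] by simp
  have E_up: "(y, s') \<in> ?E" if ys: "(y, s) \<in> ?E" "s \<le> s'" for y s s'
  proof -
    obtain a u b v where ab: "(a, u) \<in> epi (conjugate f)" "(b, v) \<in> K" "y = a + b" "s = u + v"
      using ys(1) by (auto simp: set_plus_def)
    have "(a, u + (s' - s)) + (b, v) \<in> ?E"
      using ab ys(2) by (intro set_plus_intro epi_conjugate_mono[OF ab(1)]) auto
    then show ?thesis using ab by (simp add: algebra_simps)
  qed
  show ?thesis
  proof
    assume empty: "A \<inter> eff_dom f = {}"
    have "?E \<subseteq> ?D \<times> UNIV"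
      unfolding fst_E[symmetric] by force
    then have "closure ?E \<subseteq> closure ?D \<times> UNIV"
      using closure_mono[of ?E "?D \<times> UNIV"] by (simp add: closure_Times)
    moreover have "?D \<times> UNIV \<subseteq> closure ?E"
    proof (clarify, rule ccontr)
      fix y0 r0
      assume "y0 \<in> ?D" and out: "(y0, r0) \<notin> closure ?E"
      then obtain s0 where s0: "(y0, s0) \<in> ?E"
        unfolding fst_E[symmetric] by auto
      then obtain z t where
        zt: "\<And>y r. (y, r) \<in> ?E \<Longrightarrow> dual_apply y0 z + t * r0 + 1 \<le> dual_apply y z + t * r"
        using weak_star_separation[OF convex_E _ out] by blast
      have t: "t > 0"
      proof (rule ccontr)
        assume "\<not> t > 0"
        \<comment> \<open>Over \<open>y0\<close> itself \<open>E\<close> has points at or above the level \<open>r0\<close>.\<close>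
        then have "t * max s0 r0 \<le> t * r0"
          by (intro mult_left_mono_neg) auto
        moreover have "dual_apply y0 z + t * r0 + 1 \<le> dual_apply y0 z + t * max s0 r0"
          by (intro zt E_up[OF s0]) simp
        ultimately show False by simp
      qed
      define x where "x = (- (1 / t)) *\<^sub>R z"
      define c where "c = dual_apply y0 x - r0"
      have dx: "dual_apply y x = - dual_apply y z / t" for y
        by (simp add: x_def linear_neg[OF dual_apply_linear] linear_cmul[OF dual_apply_linear])
      have bound: "dual_apply y x - r \<le> c" if "(y, r) \<in> ?E" for y r
      proof -
        have "t * (r0 - r) \<le> dual_apply y z - dual_apply y0 z"
          using zt[OF that] by (simp add: right_diff_distrib)
        then have "r0 - r \<le> (dual_apply y z - dual_apply y0 z) / t"
          using t by (simp add: pos_le_divide_eq mult.commute)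
        then show ?thesis
          by (simp add: c_def dx diff_divide_distrib)
      qed
      have "f x \<le> ereal c"
        using bound epi_E by (intro le_of_epi_conjugate_bound[OF assms(5)]) auto
      then have "x \<in> eff_dom f"
        unfolding eff_dom_def ereal_less_PInf_iff_le_real by blast
      have K_le: "dual_apply k x - s \<le> 0" if k: "(k, s) \<in> K" for k s
      proof (rule ccontr)
        assume "\<not> dual_apply k x - s \<le> 0"
        then have pos: "dual_apply k x - s > 0" by simp
        \<comment> \<open>\<open>c\<close> bounds the functional on \<open>E\<close>; adding this multiple of \<open>(k, s)\<close> to
          \<open>(y1, s1)\<close> would bring it to \<open>c + 1\<close> or more.\<close>
        define l where "l = max 0 ((c + 1 - (dual_apply y1 x - s1)) / (dual_apply k x - s))"
        have "l *\<^sub>R (k, s) \<in> K"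
          by (rule convex_cone_scaleR[OF cone_K _ k]) (simp add: l_def)
        then have "(y1, s1) + l *\<^sub>R (k, s) \<in> ?E"
          using y1 by (rule set_plus_intro[rotated])
        then have "dual_apply (y1 + l *\<^sub>R k) x - (s1 + l * s) \<le> c"
          by (intro bound) simp
        then have "dual_apply y1 x - s1 + l * (dual_apply k x - s) \<le> c"
          by (simp add: algebra_simps)
        moreover have "c + 1 - (dual_apply y1 x - s1) \<le> l * (dual_apply k x - s)"
        proof -
          have "(c + 1 - (dual_apply y1 x - s1)) / (dual_apply k x - s) \<le> l"
            by (simp add: l_def)
          then show ?thesis using pos by (simp add: pos_divide_le_eq)
        qed
        ultimately show False by simp
      qed
      have G_K: "?G \<subseteq> K"
        unfolding K_def by (rule gen_cone_superset)
      have "delta C x \<le> ereal 0"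
        using K_le G_K
        by (intro le_of_epi_conjugate_bound delta_proper_lsc_convex assms(1-3)) auto
      moreover have "f\<^sub>I i x \<le> ereal 0" if "i \<in> I" for i
        using K_le G_K that by (intro le_of_epi_conjugate_bound assms(4)) auto
      ultimately have "x \<in> A"
        by (auto simp: A_def delta_def zero_ereal_def split: if_splits)
      then show False using empty \<open>x \<in> eff_dom f\<close> by blast
    qed
    then have "closure (?D \<times> UNIV) \<subseteq> closure ?E"
      by (rule closure_minimal) simp
    then have "closure ?D \<times> UNIV \<subseteq> closure ?E"
      by (simp add: closure_Times)
    ultimately show "closure ?E = closure ?D \<times> UNIV" by (rule antisym)
  next
    assume eq: "closure ?E = closure ?D \<times> UNIV"
    show "A \<inter> eff_dom f = {}"
    proof (rule ccontr)
      assume "A \<inter> eff_dom f \<noteq> {}"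
      then obtain x where x: "x \<in> A" "x \<in> eff_dom f" by blast
      then obtain c where c: "(x, c) \<in> epi f"
        unfolding fst_epi[symmetric] by auto
      have "convex_cone {w. dual_apply (fst w) x \<le> snd w}"
        unfolding convex_cone_iff by (auto intro: add_mono mult_left_mono)
      moreover have "?G \<subseteq> {w. dual_apply (fst w) x \<le> snd w}"
      proof -
        have "dual_apply y x \<le> s" if "(y, s) \<in> epi (conjugate (delta C))" for y s
          using that x(1) by (simp add: mem_epi_conjugate_delta A_def)
        moreover have "dual_apply y x \<le> s" if "i \<in> I" "(y, s) \<in> epi (conjugate (f\<^sub>I i))" for i y s
        proof -
          have "(x, 0) \<in> epi (f\<^sub>I i)"
            using x(1) that(1) by (simp add: A_def mem_epi zero_ereal_def)
          then show ?thesis using that(2) unfolding mem_epi_conjugate by force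
        qed
        ultimately show ?thesis by auto
      qed
      ultimately have K_le: "K \<subseteq> {w. dual_apply (fst w) x \<le> snd w}"
        unfolding K_def gen_cone_eq by (intro hull_minimal)
      let ?H = "{w :: 'a topdual \<times> real. dual_apply (fst w) x \<le> c + snd w}"
      have "?E \<subseteq> ?H"
      proof
        fix w assume "w \<in> ?E"
        then obtain y s k u where w: "w = (y, s) + (k, u)" "(y, s) \<in> epi (conjugate f)" "(k, u) \<in> K"
          by (auto simp: set_plus_def)
        have "dual_apply y x \<le> c + s" using w(2) c by (simp add: mem_epi_conjugate)
        moreover have "dual_apply k x \<le> u" using w(3) K_le by auto
        ultimately show "w \<in> ?H" using w(1) by simp
      qed
      moreover have "closed ?H"
        by (intro closed_Collect_le continuous_intros
            continuous_on_compose2[OF continuous_evaluation continuous_on_fst[OF continuous_on_id]]) auto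
      ultimately have "closure ?E \<subseteq> ?H" by (rule closure_minimal)
      moreover have "(y1, dual_apply y1 x - c - 1) \<in> closure ?E"
      proof -
        have "y1 \<in> ?D"
          unfolding fst_E[symmetric] using epi_E[OF y1] by force
        then show ?thesis
          unfolding eq using closure_subset[of ?D] by blast
      qed
      ultimately show False by auto
    qed
  qed
qed

end
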